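(* Let $C_\beta,C_\varepsilon>0$, let $K$ be a positive integer, and let $c=13+\frac{18}{e}$ and $m\ge1$ be constants. Suppose that $C_\beta$, $C_\varepsilon$, $K$, $R$, $L_0^f$, $L_1^f$, $\|A\|$, $\|A^\top A\|$ and $\|y^\star\|$ are independent of the target accuracy $\varepsilon>0$. Then $$L_0^{\mathcal{L}}=L_0^f+\frac{C_\beta}{K\varepsilon}\|A^\top A\|+L_1^f\|A\|\left(2M_y+\sqrt{\frac{2C_\beta}{K\varepsilon}\bigl(\mathcal{L}(x_s)-f^\star\bigr)+M_y^2}\right)$$ satisfies $L_0^{\mathcal{L}}=\mathcal{O}(1/\varepsilon)$ as $\varepsilon\to0$. Consequently, the quantity $$T_K=(m+1)KR\sqrt{\frac{10C_\beta L_0^{\mathcal{L}}}{C_\varepsilon\varepsilon}}+cK(L_1^fR)^2$$ (the bound on the total number of gradient evaluations of the inexact augmented Lagrangian method) obeys $$T_K=\mathcal{O}\!\left(\frac{K}{\varepsilon}\right)+\mathcal{O}(K),$$ and therefore, for fixed $K$, $T_K=\mathcal{O}(1/\varepsilon)$ as $\varepsilon\to0$.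
   Context: Norms are Euclidean for vectors and spectral for matrices. Problem: $\min_{x\in Q}f(x)$ subject to $Ax=b$, with $Q\subset\mathbb{R}^n$ convex compact, $A\in\mathbb{R}^{p\times n}$, $b\in\mathbb{R}^p$, and $f$ convex and $(L_0^f,L_1^f)$-smooth, i.e. twice differentiable with $\|\nabla^2f(x)\|\le L_0^f+L_1^f\|\nabla f(x)\|$ for all $x$, $L_0^f,L_1^f>0$. A KKT point $(x^\star,y^\star)$ exists ($0\in\nabla f(x^\star)+A^\top y^\star+N_Q(x^\star)$, $Ax^\star=b$). $R=\max_{x,y\in Q}\|x-y\|$; $f^\star$ is the (finite) infimum of $f$; $M_y=2\|y^\star\|+\sqrt{C_\varepsilon}$. The inexact augmented Lagrangian method uses $\mathcal{L}_{\beta}(x,y)=f(x)+y^\top(Ax-b)+\frac{\beta}{2}\|Ax-b\|^2$ with $\beta_k=\rho_k=\frac{C_\beta}{K\varepsilon}$, $y^0=0$, accuracies $\varepsilon_k$ with $\sum_{k=0}^{K-1}\rho_k\varepsilon_k\le\frac{C_\varepsilon}{2}$; for $k=0,\dots,K-1$ it computes $x^{k+1}\in Q$ with $\mathcal{L}_{\beta_k}(x^{k+1},y^k)-\min_{x\in Q}\mathcal{L}_{\beta_k}(x,y^k)\le\varepsilon_k$ and sets $y^{k+1}=y^k+\beta_k(Ax^{k+1}-b)$. The dual iterates satisfy $\|y^k\|\le M_y$. Here $x_s\in Q$ is the starting point of the subproblem, and $\mathcal{L}(x_s)=\mathcal{L}_{\beta_k}(x_s,y^k)$, taken as its maximum over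 $k=0,\dots,K-1$. *)

theory Defs
  imports "HOL-Analysis.Analysis" "HOL-Library.Landau_Symbols"
begin

definition spectral_norm :: "real ^ 'n ^ 'm \<Rightarrow> real" where
  "spectral_norm A = onorm ((*v) A)"

definition gradient :: "('a::euclidean_space \<Rightarrow> real) \<Rightarrow> 'a \<Rightarrow> 'a" where
  "gradient f x = (THE g. GDERIV f x :> g)"

definition hessian :: "(real ^ 'n \<Rightarrow> real) \<Rightarrow> real ^ 'n \<Rightarrow> real ^ 'n ^ 'n" where
  "hessian f x = matrix (frechet_derivative (gradient f) (at x))"

definition twice_differentiable :: "(real ^ 'n \<Rightarrow> real) \<Rightarrow> bool" where
  "twice_differentiable f \<longleftrightarrow>
     (\<forall>x. f differentiable (at x)) \<and> (\<forall>x. gradient f differentiable (at x))"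

definition L0_L1_smooth :: "real \<Rightarrow> real \<Rightarrow> (real ^ 'n \<Rightarrow> real) \<Rightarrow> bool" where
  "L0_L1_smooth L0 L1 f \<longleftrightarrow>
     0 < L0 \<and> 0 < L1 \<and> twice_differentiable f \<and>
     (\<forall>x. spectral_norm (hessian f x) \<le> L0 + L1 * norm (gradient f x))"

(* Empty outside Q, as usual in convex analysis. *)
definition normal_cone :: "'a::real_inner set \<Rightarrow> 'a \<Rightarrow> 'a set" where
  "normal_cone Q x = {v. x \<in> Q \<and> (\<forall>z\<in>Q. v \<bullet> (z - x) \<le> 0)}"

definition KKT_point ::
  "(real ^ 'n \<Rightarrow> real) \<Rightarrow> real ^ 'n ^ 'p \<Rightarrow> real ^ 'p \<Rightarrow> (real ^ 'n) set \<Rightarrow> real ^ 'n \<Rightarrow> real ^ 'p \<Rightarrow> bool"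
where
  "KKT_point f A b Q x y \<longleftrightarrow>
     (\<exists>v\<in>normal_cone Q x. 0 = gradient f x + transpose A *v y + v) \<and> A *v x = b"

definition aug_lagrangian ::
  "(real ^ 'n \<Rightarrow> real) \<Rightarrow> real ^ 'n ^ 'p \<Rightarrow> real ^ 'p \<Rightarrow> real \<Rightarrow> real ^ 'n \<Rightarrow> real ^ 'p \<Rightarrow> real"
where
  "aug_lagrangian f A b \<beta> x y =
     f x + y \<bullet> (A *v x - b) + \<beta> / 2 * (norm (A *v x - b))\<^sup>2"

(* The common value of the penalty parameters beta_k and the dual step sizes rho_k. *)
definition penalty :: "real \<Rightarrow> nat \<Rightarrow> real \<Rightarrow> real" where
  "penalty C\<beta> K \<epsilon> = C\<beta> / (real K * \<epsilon>)"

(* The primal iterates are x 1, ..., x K (x 0 plays no role) and the dual iterates y 0, ..., y K.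
   The infimum over Q is attained when Q is compact and nonempty and f is continuous. *)
definition inexact_ALM ::
  "(real ^ 'n \<Rightarrow> real) \<Rightarrow> real ^ 'n ^ 'p \<Rightarrow> real ^ 'p \<Rightarrow> (real ^ 'n) set \<Rightarrow> real \<Rightarrow> real \<Rightarrow> nat \<Rightarrow> real \<Rightarrow>
   (nat \<Rightarrow> real) \<Rightarrow> (nat \<Rightarrow> real ^ 'n) \<Rightarrow> (nat \<Rightarrow> real ^ 'p) \<Rightarrow> bool"
where
  "inexact_ALM f A b Q C\<beta> C\<epsilon> K \<epsilon> acc x y \<longleftrightarrow>
     (let \<beta> = penalty C\<beta> K \<epsilon> in
       y 0 = 0 \<and>
       (\<Sum>k<K. \<beta> * acc k) \<le> C\<epsilon> / 2 \<and>
       (\<forall>k<K. x (Suc k) \<in> Q \<and>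
              aug_lagrangian f A b \<beta> (x (Suc k)) (y k)
                - (INF z\<in>Q. aug_lagrangian f A b \<beta> z (y k)) \<le> acc k \<and>
              y (Suc k) = y k + \<beta> *\<^sub>R (A *v x (Suc k) - b)))"

definition dual_bound :: "real \<Rightarrow> real ^ 'p \<Rightarrow> real" where
  "dual_bound C\<epsilon> ystar = 2 * norm ystar + sqrt C\<epsilon>"

(* xs k is the starting point of the k-th subproblem. *)
definition start_value ::
  "(real ^ 'n \<Rightarrow> real) \<Rightarrow> real ^ 'n ^ 'p \<Rightarrow> real ^ 'p \<Rightarrow> real \<Rightarrow> nat \<Rightarrow>
   (nat \<Rightarrow> real ^ 'n) \<Rightarrow> (nat \<Rightarrow> real ^ 'p) \<Rightarrow> real"
where
  "start_value f A b \<beta> K xs y = (MAX k\<in>{..<K}. aug_lagrangian f A b \<beta> (xs k) (y k))"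

(* M bounds the dual iterates, Ls is the Lagrangian at the starting points
   and fstar is the infimum of f. *)
definition L0_lagrangian ::
  "real ^ 'n ^ 'p \<Rightarrow> real \<Rightarrow> real \<Rightarrow> real \<Rightarrow> nat \<Rightarrow> real \<Rightarrow> real \<Rightarrow> real \<Rightarrow> real \<Rightarrow> real"
where
  "L0_lagrangian A L0f L1f C\<beta> K \<epsilon> M Ls fstar =
     L0f + C\<beta> / (real K * \<epsilon>) * spectral_norm (transpose A ** A)
       + L1f * spectral_norm A
           * (2 * M + sqrt (2 * C\<beta> / (real K * \<epsilon>) * (Ls - fstar) + M\<^sup>2))"

definition grad_eval_bound ::
  "real \<Rightarrow> nat \<Rightarrow> real \<Rightarrow> real \<Rightarrow> real \<Rightarrow> real \<Rightarrow> real \<Rightarrow> real \<Rightarrow> real"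
where
  "grad_eval_bound m K R L1f C\<beta> C\<epsilon> \<epsilon> L0L =
     (m + 1) * real K * R * sqrt (10 * C\<beta> * L0L / (C\<epsilon> * \<epsilon>))
       + (13 + 18 / exp 1) * real K * (L1f * R)\<^sup>2"

end

theory Submission
  imports Defs
begin

text \<open>
  The point of the theorem is a bound \<open>\<bar>L0L\<bar> \<le> P / \<epsilon>\<close> for \<open>0 < \<epsilon> \<le> 1\<close> whose constant \<open>P\<close> does not
  depend on \<open>K\<close>. On the compact set \<open>Q\<close> both \<open>f\<close> and the residual \<open>A z - b\<close> are bounded, the
  latter by \<open>B\<close>, say. Each of the at most \<open>K\<close> dual steps has length at most
  \<open>\<beta> B = C\<beta> B / (K \<epsilon>)\<close>, so \<open>norm y\<^sub>k \<le> C\<beta> B / \<epsilon>\<close>: the number of steps cancels the \<open>K\<close> in the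
  penalty. (This crude bound suffices; the \<open>\<epsilon>\<close>-independent bound \<open>M\<^sub>y\<close> on the dual iterates
  would only improve the constants.) Hence the augmented Lagrangian is \<open>O(1/\<epsilon>)\<close> on \<open>Q\<close>
  (\<open>aug_lagrangian_bound\<close>). In \<open>L0_lagrangian\<close> this value is multiplied by another
  \<open>O(1/\<epsilon>)\<close> under a square root, and every remaining term is \<open>O(1/\<epsilon>)\<close>
  (\<open>L0_lagrangian_bound\<close>).

  In \<open>T\<close> the radicand \<open>L0L / \<epsilon>\<close> is then \<open>O(1/\<epsilon>\<^sup>2)\<close>, so the first summand is
  \<open>O(K / \<epsilon>)\<close> uniformly in \<open>K\<close>, while the second is a constant times \<open>K\<close>.
  All estimates are on absolute values, so the signs of the radicands are irrelevant.
\<close>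

section \<open>Bounds at a fixed accuracy\<close>

text \<open>No sign condition on \<open>z\<close> is needed, because \<open>sqrt\<close> is an odd function on the reals.\<close>

lemma abs_sqrt_le_divide:
  fixes z c \<epsilon> :: real
  assumes "\<bar>z\<bar> \<le> c / \<epsilon>\<^sup>2" "\<epsilon> > 0"
  shows "\<bar>sqrt z\<bar> \<le> sqrt c / \<epsilon>"
proof -
  have "\<bar>sqrt z\<bar> = sqrt \<bar>z\<bar>"
    by (simp add: abs_if real_sqrt_minus)
  also have "\<dots> \<le> sqrt (c / \<epsilon>\<^sup>2)"
    using assms by (intro real_sqrt_le_mono)
  also have "\<dots> = sqrt c / \<epsilon>"
    using assms by (simp add: real_sqrt_divide)
  finally show ?thesis .
qed

text \<open>
  The constant is independent of \<open>K\<close>: up to \<open>K\<close> steps, each of length at most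
  \<open>C\<beta> * B / (K * \<epsilon>)\<close>.
\<close>

lemma dual_iterates_bound:
  assumes alm: "inexact_ALM f A b Q C\<beta> C\<epsilon> K \<epsilon> acc x y"
    and B: "\<And>z. z \<in> Q \<Longrightarrow> norm (A *v z - b) \<le> B"
    and pos: "C\<beta> > 0" "\<epsilon> > 0" "K \<ge> 1" and B0: "B \<ge> 0" and "k \<le> K"
  shows "norm (y k) \<le> C\<beta> * B / \<epsilon>"
proof -
  define \<beta> where "\<beta> = penalty C\<beta> K \<epsilon>"
  have \<beta>0: "\<beta> \<ge> 0"
    using pos by (simp add: \<beta>_def penalty_def)
  have steps: "norm (y k) \<le> real k * (\<beta> * B)"
    using \<open>k \<le> K\<close>
  proof (induction k)
    case 0
    then show ?case using alm by (simp add: inexact_ALM_def Let_def)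
  next
    case (Suc k)
    then have x: "x (Suc k) \<in> Q" and y: "y (Suc k) = y k + \<beta> *\<^sub>R (A *v x (Suc k) - b)"
      using alm by (auto simp: inexact_ALM_def Let_def \<beta>_def)
    have "norm (y (Suc k)) \<le> norm (y k) + \<beta> * norm (A *v x (Suc k) - b)"
      unfolding y using norm_triangle_ineq[of "y k"] \<beta>0 by (metis abs_of_nonneg norm_scaleR)
    also have "\<dots> \<le> real k * (\<beta> * B) + \<beta> * B"
      using Suc B[OF x] \<beta>0 by (intro add_mono mult_left_mono) auto
    finally show ?case by (simp add: algebra_simps)
  qed
  have "real k * (\<beta> * B) \<le> real K * (\<beta> * B)"
    using \<open>k \<le> K\<close> \<beta>0 B0 by (intro mult_right_mono) auto
  also have "\<dots> = C\<beta> * B / \<epsilon>"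
    using pos by (simp add: \<beta>_def penalty_def)
  finally show ?thesis using steps by simp
qed

lemma penalty_le:
  assumes "C\<beta> > 0" "\<epsilon> > 0" "K \<ge> 1"
  shows "penalty C\<beta> K \<epsilon> \<le> C\<beta> / \<epsilon>"
proof -
  have "1 * \<epsilon> \<le> real K * \<epsilon>"
    using assms by (intro mult_right_mono) auto
  then show ?thesis
    unfolding penalty_def using assms by (intro divide_left_mono) auto
qed

lemma aug_lagrangian_bound:
  assumes F: "\<bar>f z\<bar> \<le> F" and B: "norm (A *v z - b) \<le> B"
    and y: "norm y \<le> C\<beta> * B / \<epsilon>"
    and \<beta>: "0 \<le> \<beta>" "\<beta> \<le> C\<beta> / \<epsilon>"
    and \<epsilon>: "0 < \<epsilon>" "\<epsilon> \<le> 1"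
  shows "\<bar>aug_lagrangian f A b \<beta> z y\<bar> \<le> (F + 2 * C\<beta> * B\<^sup>2) / \<epsilon>"
proof -
  have C0: "C\<beta> / \<epsilon> \<ge> 0" using \<beta> by linarith
  have f: "\<bar>f z\<bar> \<le> F / \<epsilon>"
    using F \<epsilon> divide_left_mono[of \<epsilon> 1 F] by (smt (verit) abs_ge_zero div_by_1 mult_pos_pos)
  have "\<bar>y \<bullet> (A *v z - b)\<bar> \<le> norm y * norm (A *v z - b)"
    by (rule Cauchy_Schwarz_ineq2)
  also have "\<dots> \<le> C\<beta> * B / \<epsilon> * B"
    using y B by (intro mult_mono) (auto intro: order_trans[OF norm_ge_zero])
  finally have i: "\<bar>y \<bullet> (A *v z - b)\<bar> \<le> C\<beta> / \<epsilon> * B\<^sup>2"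
    by (simp add: power2_eq_square)
  have q: "\<beta> / 2 * (norm (A *v z - b))\<^sup>2 \<le> C\<beta> / \<epsilon> * B\<^sup>2"
    using B \<beta> C0 by (intro mult_mono power_mono norm_ge_zero zero_le_power2) linarith+
  have "0 \<le> \<beta> / 2 * (norm (A *v z - b))\<^sup>2"
    using \<beta> by simp
  then have "\<bar>aug_lagrangian f A b \<beta> z y\<bar> \<le> F / \<epsilon> + C\<beta> / \<epsilon> * B\<^sup>2 + C\<beta> / \<epsilon> * B\<^sup>2"
    unfolding aug_lagrangian_def using f i q by linarith
  then show ?thesis by (simp add: add_divide_distrib)
qed

lemma L0_lagrangian_bound:
  assumes S: "\<bar>Ls - fstar\<bar> \<le> S / \<epsilon>"
    and pos: "C\<beta> > 0" "K \<ge> 1" "L0f > 0" "L1f > 0"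
    and \<epsilon>: "0 < \<epsilon>" "\<epsilon> \<le> 1"
  shows "\<bar>L0_lagrangian A L0f L1f C\<beta> K \<epsilon> M Ls fstar\<bar> \<le>
    (L0f + C\<beta> * \<bar>spectral_norm (transpose A ** A)\<bar>
      + L1f * \<bar>spectral_norm A\<bar> * (2 * \<bar>M\<bar> + sqrt (2 * C\<beta> * S + M\<^sup>2))) / \<epsilon>"
proof -
  define \<beta> where "\<beta> = C\<beta> / (real K * \<epsilon>)"
  define r where "r = 2 * \<beta> * (Ls - fstar) + M\<^sup>2"
  have \<beta>: "0 \<le> \<beta>" "\<beta> \<le> C\<beta> / \<epsilon>"
    using penalty_le[of C\<beta> \<epsilon> K] pos \<epsilon> by (auto simp: \<beta>_def penalty_def)
  \<comment> \<open>As \<open>\<epsilon> \<le> 1\<close>, constants are absorbed into the leading power of \<open>1 / \<epsilon>\<close>.\<close>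
  have le: "c \<le> c / \<epsilon>" "c \<le> c / \<epsilon>\<^sup>2" if "c \<ge> 0" for c :: real
    using that \<epsilon> divide_left_mono[of \<epsilon> 1 c] divide_left_mono[of "\<epsilon>\<^sup>2" 1 c]
    by (auto simp: power_le_one)
  have "\<bar>r\<bar> \<le> 2 * \<beta> * \<bar>Ls - fstar\<bar> + M\<^sup>2"
    unfolding r_def using \<beta> by (intro order_trans[OF abs_triangle_ineq]) (simp add: abs_mult)
  also have "\<dots> \<le> 2 * (C\<beta> / \<epsilon>) * (S / \<epsilon>) + M\<^sup>2 / \<epsilon>\<^sup>2"
    using S \<beta> le(2)[of "M\<^sup>2"] by (intro add_mono mult_mono) auto
  also have "\<dots> = (2 * C\<beta> * S + M\<^sup>2) / \<epsilon>\<^sup>2"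
    by (simp add: add_divide_distrib power2_eq_square)
  finally have r: "\<bar>sqrt r\<bar> \<le> sqrt (2 * C\<beta> * S + M\<^sup>2) / \<epsilon>"
    using \<epsilon> by (intro abs_sqrt_le_divide)
  have "\<bar>2 * M + sqrt r\<bar> \<le> 2 * \<bar>M\<bar> / \<epsilon> + sqrt (2 * C\<beta> * S + M\<^sup>2) / \<epsilon>"
    using r le(1)[of "2 * \<bar>M\<bar>"] by linarith
  then have "\<bar>L1f * spectral_norm A * (2 * M + sqrt r)\<bar> \<le>
      L1f * \<bar>spectral_norm A\<bar> * (2 * \<bar>M\<bar> / \<epsilon> + sqrt (2 * C\<beta> * S + M\<^sup>2) / \<epsilon>)"
    using pos by (simp add: abs_mult mult_left_mono)
  moreover have "\<bar>\<beta> * spectral_norm (transpose A ** A)\<bar>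
      \<le> C\<beta> / \<epsilon> * \<bar>spectral_norm (transpose A ** A)\<bar>"
    using mult_right_mono[OF \<beta>(2) abs_ge_zero] \<beta>(1) by (simp add: abs_mult)
  moreover have "\<bar>L0f\<bar> \<le> L0f / \<epsilon>"
    using pos le(1)[of L0f] by simp
  moreover have "L0_lagrangian A L0f L1f C\<beta> K \<epsilon> M Ls fstar =
      L0f + \<beta> * spectral_norm (transpose A ** A) + L1f * spectral_norm A * (2 * M + sqrt r)"
    by (simp add: L0_lagrangian_def r_def \<beta>_def)
  ultimately have "\<bar>L0_lagrangian A L0f L1f C\<beta> K \<epsilon> M Ls fstar\<bar> \<le>
      L0f / \<epsilon> + C\<beta> / \<epsilon> * \<bar>spectral_norm (transpose A ** A)\<bar>
      + L1f * \<bar>spectral_norm A\<bar> * (2 * \<bar>M\<bar> / \<epsilon> + sqrt (2 * C\<beta> * S + M\<^sup>2) / \<epsilon>)"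
    by linarith
  also have "\<dots> = (L0f + C\<beta> * \<bar>spectral_norm (transpose A ** A)\<bar>
      + L1f * \<bar>spectral_norm A\<bar> * (2 * \<bar>M\<bar> + sqrt (2 * C\<beta> * S + M\<^sup>2))) / \<epsilon>"
    by (simp add: add_divide_distrib distrib_left)
  finally show ?thesis .
qed

section \<open>Asymptotics as the accuracy tends to zero\<close>

lemma compact_objective_residual_bounds:
  fixes f :: "real ^ 'n \<Rightarrow> real" and A :: "real ^ 'n ^ 'p"
  assumes "compact Q" "twice_differentiable f"
  obtains F B where "F \<ge> 0" "B \<ge> 0"
    "\<And>z. z \<in> Q \<Longrightarrow> \<bar>f z\<bar> \<le> F" "\<And>z. z \<in> Q \<Longrightarrow> norm (A *v z - b) \<le> B"
proof -
  have "continuous_on Q f"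
    using assms(2) differentiable_imp_continuous_within
    by (auto simp: twice_differentiable_def intro!: continuous_at_imp_continuous_on)
  then have "bounded (f ` Q)"
    using assms(1) by (intro compact_imp_bounded compact_continuous_image)
  then obtain F where F: "F > 0" "\<And>z. z \<in> Q \<Longrightarrow> \<bar>f z\<bar> \<le> F"
    by (auto simp: bounded_pos)
  have "continuous_on Q (\<lambda>z. A *v z - b)"
    by (intro continuous_intros)
  then have "bounded ((\<lambda>z. A *v z - b) ` Q)"
    using assms(1) by (intro compact_imp_bounded compact_continuous_image)
  then obtain B where B: "B > 0" "\<And>z. z \<in> Q \<Longrightarrow> norm (A *v z - b) \<le> B"
    by (auto simp: bounded_pos)
  show ?thesis using that[of F B] F B by simp
qed

theorem mainTheorem3:
  fixes f :: "real ^ 'n \<Rightarrow> real" and A :: "real ^ 'n ^ 'p" and b :: "real ^ 'p"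
    and Q :: "(real ^ 'n) set"
    and L0f L1f C\<beta> C\<epsilon> m :: real
    and xstar :: "real ^ 'n" and ystar :: "real ^ 'p"
    and acc :: "nat \<Rightarrow> real \<Rightarrow> nat \<Rightarrow> real"
    and x xs :: "nat \<Rightarrow> real \<Rightarrow> nat \<Rightarrow> real ^ 'n"
    and y :: "nat \<Rightarrow> real \<Rightarrow> nat \<Rightarrow> real ^ 'p"
    and L0L T :: "nat \<Rightarrow> real \<Rightarrow> real"
  assumes "convex Q" and "compact Q"
    and "convex_on UNIV f" and "L0_L1_smooth L0f L1f f"
    and "bdd_below (range f)"
    and "KKT_point f A b Q xstar ystar"
    and "C\<beta> > 0" and "C\<epsilon> > 0" and "m \<ge> 1"
    and "\<And>K \<epsilon>. K \<ge> 1 \<Longrightarrow> \<epsilon> > 0 \<Longrightarrow>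
           inexact_ALM f A b Q C\<beta> C\<epsilon> K \<epsilon> (acc K \<epsilon>) (x K \<epsilon>) (y K \<epsilon>)"
    and "\<And>K \<epsilon> k. K \<ge> 1 \<Longrightarrow> \<epsilon> > 0 \<Longrightarrow> k < K \<Longrightarrow> xs K \<epsilon> k \<in> Q"
    and L0L: "\<And>K \<epsilon>. K \<ge> 1 \<Longrightarrow> \<epsilon> > 0 \<Longrightarrow>
           L0L K \<epsilon> = L0_lagrangian A L0f L1f C\<beta> K \<epsilon> (dual_bound C\<epsilon> ystar)
             (start_value f A b (penalty C\<beta> K \<epsilon>) K (xs K \<epsilon>) (y K \<epsilon>)) (INF z. f z)"
    and T: "\<And>K \<epsilon>. K \<ge> 1 \<Longrightarrow> \<epsilon> > 0 \<Longrightarrow>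
           T K \<epsilon> = grad_eval_bound m K (diameter Q) L1f C\<beta> C\<epsilon> \<epsilon> (L0L K \<epsilon>)"
  shows "(\<forall>K\<ge>1. (\<lambda>\<epsilon>. L0L K \<epsilon>) \<in> O[at_right 0](\<lambda>\<epsilon>. 1 / \<epsilon>)) \<and>
         (\<exists>g h. (\<forall>K\<ge>1. \<forall>\<epsilon>>0. T K \<epsilon> = g (K, \<epsilon>) + h (K, \<epsilon>)) \<and>
            g \<in> O[principal {1..} \<times>\<^sub>F at_right 0](\<lambda>(K, \<epsilon>). real K / \<epsilon>) \<and>
            h \<in> O[principal {1..} \<times>\<^sub>F at_right 0](\<lambda>(K, \<epsilon>). real K)) \<and>
         (\<forall>K\<ge>1. (\<lambda>\<epsilon>. T K \<epsilon>) \<in> O[at_right 0](\<lambda>\<epsilon>. 1 / \<epsilon>))"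
proof -
  have smooth: "L0f > 0" "L1f > 0" "twice_differentiable f"
    using assms(4) by (auto simp: L0_L1_smooth_def)
  obtain F B where F: "F \<ge> 0" "\<And>z. z \<in> Q \<Longrightarrow> \<bar>f z\<bar> \<le> F"
    and B: "B \<ge> 0" "\<And>z. z \<in> Q \<Longrightarrow> norm (A *v z - b) \<le> B"
    using compact_objective_residual_bounds[OF assms(2) smooth(3)] by metis
  define M where "M = dual_bound C\<epsilon> ystar"
  define fs where "fs = (INF z. f z)"
  define S where "S = F + 2 * C\<beta> * B\<^sup>2 + \<bar>fs\<bar>"
  define P where "P = L0f + C\<beta> * \<bar>spectral_norm (transpose A ** A)\<bar>
      + L1f * \<bar>spectral_norm A\<bar> * (2 * \<bar>M\<bar> + sqrt (2 * C\<beta> * S + M\<^sup>2))"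

  have L0L_bound: "\<bar>L0L K \<epsilon>\<bar> \<le> P / \<epsilon>" if K: "K \<ge> 1" and \<epsilon>: "0 < \<epsilon>" "\<epsilon> \<le> 1" for K \<epsilon>
  proof -
    define \<beta> where "\<beta> = penalty C\<beta> K \<epsilon>"
    define Ls where "Ls = start_value f A b \<beta> K (xs K \<epsilon>) (y K \<epsilon>)"
    \<comment> \<open>The maximum is over a nonempty finite set, so it is the value at some subproblem \<open>k\<close>.\<close>
    have "Ls \<in> (\<lambda>k. aug_lagrangian f A b \<beta> (xs K \<epsilon> k) (y K \<epsilon> k)) ` {..<K}"
      unfolding Ls_def start_value_def using K by (intro Max_in) (auto simp: lessThan_empty_iff)
    then obtain k where k: "k < K" and Ls: "Ls = aug_lagrangian f A b \<beta> (xs K \<epsilon> k) (y K \<epsilon> k)"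
      by auto
    have xs: "xs K \<epsilon> k \<in> Q"
      using assms(11) K \<epsilon>(1) k by blast
    have "norm (y K \<epsilon> k) \<le> C\<beta> * B / \<epsilon>"
      using dual_iterates_bound[OF assms(10)[OF K \<epsilon>(1)] B(2) assms(7) \<epsilon>(1) K B(1)] k by simp
    moreover have "0 \<le> \<beta>" "\<beta> \<le> C\<beta> / \<epsilon>"
      using penalty_le[OF assms(7) \<epsilon>(1) K] assms(7) \<epsilon>(1) by (auto simp: \<beta>_def penalty_def)
    ultimately have "\<bar>Ls\<bar> \<le> (F + 2 * C\<beta> * B\<^sup>2) / \<epsilon>"
      unfolding Ls using aug_lagrangian_bound F(2)[OF xs] B(2)[OF xs] \<epsilon> by blast
    moreover have "\<bar>fs\<bar> \<le> \<bar>fs\<bar> / \<epsilon>"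
      using \<epsilon> divide_left_mono[of \<epsilon> 1 "\<bar>fs\<bar>"] by simp
    ultimately have "\<bar>Ls - fs\<bar> \<le> S / \<epsilon>"
      unfolding S_def by (simp add: add_divide_distrib)
    from L0_lagrangian_bound[OF this assms(7) K smooth(1,2) \<epsilon>] show ?thesis
      unfolding L0L[OF K \<epsilon>(1)] P_def M_def fs_def Ls_def \<beta>_def .
  qed

  define R where "R = diameter Q"
  define g where "g = (\<lambda>(K, \<epsilon>). (m + 1) * real K * R * sqrt (10 * C\<beta> * L0L K \<epsilon> / (C\<epsilon> * \<epsilon>)))"
  define h :: "nat \<times> real \<Rightarrow> real"
    where "h = (\<lambda>(K, \<epsilon>). (13 + 18 / exp 1) * real K * (L1f * R)\<^sup>2)"
  define G where "G = (m + 1) * \<bar>R\<bar> * sqrt (10 * C\<beta> * P / C\<epsilon>)"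
  define H where "H = (13 + 18 / exp 1) * (L1f * R)\<^sup>2"
  have H0: "H \<ge> 0" unfolding H_def by (simp add: add_nonneg_nonneg)
  have T_split: "T K \<epsilon> = g (K, \<epsilon>) + h (K, \<epsilon>)" if "K \<ge> 1" "\<epsilon> > 0" for K \<epsilon>
    using T[OF that] by (simp add: grad_eval_bound_def g_def h_def R_def)
  have h_eq: "h (K, \<epsilon>) = H * real K" for K \<epsilon>
    by (simp add: h_def H_def)
  have g_bound: "\<bar>g (K, \<epsilon>)\<bar> \<le> G * (real K / \<epsilon>)" if K: "K \<ge> 1" and \<epsilon>: "0 < \<epsilon>" "\<epsilon> \<le> 1" for K \<epsilon>
  proof -
    have "\<bar>10 * C\<beta> * L0L K \<epsilon> / (C\<epsilon> * \<epsilon>)\<bar> = 10 * C\<beta> / (C\<epsilon> * \<epsilon>) * \<bar>L0L K \<epsilon>\<bar>"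
      using assms(7,8) \<epsilon> by (simp add: abs_mult)
    also have "\<dots> \<le> 10 * C\<beta> / (C\<epsilon> * \<epsilon>) * (P / \<epsilon>)"
      using assms(7,8) \<epsilon> L0L_bound[OF K \<epsilon>] by (intro mult_left_mono) auto
    also have "\<dots> = (10 * C\<beta> * P / C\<epsilon>) / \<epsilon>\<^sup>2"
      by (simp add: power2_eq_square)
    finally have *: "\<bar>sqrt (10 * C\<beta> * L0L K \<epsilon> / (C\<epsilon> * \<epsilon>))\<bar> \<le> sqrt (10 * C\<beta> * P / C\<epsilon>) / \<epsilon>"
      using \<epsilon> by (intro abs_sqrt_le_divide)
    have "\<bar>g (K, \<epsilon>)\<bar> = (m + 1) * real K * \<bar>R\<bar> * \<bar>sqrt (10 * C\<beta> * L0L K \<epsilon> / (C\<epsilon> * \<epsilon>))\<bar>"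
      using assms(9) by (simp add: g_def abs_mult)
    also have "\<dots> \<le> (m + 1) * real K * \<bar>R\<bar> * (sqrt (10 * C\<beta> * P / C\<epsilon>) / \<epsilon>)"
      using * assms(9) by (intro mult_left_mono) auto
    finally show ?thesis by (simp add: G_def mult_ac)
  qed

  have small: "\<forall>\<^sub>F \<epsilon> in at_right (0::real). 0 < \<epsilon> \<and> \<epsilon> \<le> 1"
    by (auto simp: eventually_at_right_field intro: exI[of _ 1])
  have small_prod: "\<forall>\<^sub>F p in principal {1::nat..} \<times>\<^sub>F at_right (0::real).
      1 \<le> fst p \<and> 0 < snd p \<and> snd p \<le> 1"
    unfolding eventually_prod_filter
    by (intro exI[of _ "\<lambda>K. K \<ge> 1"] exI[of _ "\<lambda>\<epsilon>. 0 < \<epsilon> \<and> \<epsilon> \<le> 1"])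
       (auto simp: eventually_principal small)

  have L0L_bigo: "(\<lambda>\<epsilon>. L0L K \<epsilon>) \<in> O[at_right 0](\<lambda>\<epsilon>. 1 / \<epsilon>)" if "K \<ge> 1" for K
    by (rule bigoI[of _ P], rule eventually_mono[OF small])
       (use L0L_bound[OF that] in auto)
  have g_bigo: "g \<in> O[principal {1..} \<times>\<^sub>F at_right 0](\<lambda>(K, \<epsilon>). real K / \<epsilon>)"
    by (rule bigoI[of _ G], rule eventually_mono[OF small_prod])
       (use g_bound in auto)
  have h_bigo: "h \<in> O[principal {1..} \<times>\<^sub>F at_right 0](\<lambda>(K, \<epsilon>). real K)"
    by (rule bigoI[of _ H], rule always_eventually)
       (use H0 in \<open>auto simp: h_eq abs_mult split_paired_all\<close>)
  have T_bigo: "(\<lambda>\<epsilon>. T K \<epsilon>) \<in> O[at_right 0](\<lambda>\<epsilon>. 1 / \<epsilon>)" if K: "K \<ge> 1" for K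
  proof (rule bigoI[of _ "(G + H) * real K"], rule eventually_mono[OF small])
    fix \<epsilon> :: real
    assume \<epsilon>: "0 < \<epsilon> \<and> \<epsilon> \<le> 1"
    have "H * real K \<le> H * real K / \<epsilon>"
      using \<epsilon> H0 divide_left_mono[of \<epsilon> 1 "H * real K"] by simp
    moreover have "0 \<le> H * real K" using H0 by simp
    ultimately have "\<bar>T K \<epsilon>\<bar> \<le> G * (real K / \<epsilon>) + H * real K / \<epsilon>"
      using T_split[OF K, of \<epsilon>] g_bound[OF K, of \<epsilon>] h_eq[of K \<epsilon>] \<epsilon> by linarith
    then show "norm (T K \<epsilon>) \<le> (G + H) * real K * norm (1 / \<epsilon>)"
      using \<epsilon> by (simp add: add_divide_distrib distrib_right)
  qed
  show ?thesis
    using L0L_bigo T_split g_bigo h_bigo T_bigo by blast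
qed

end
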